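(* Let $N,K,b\in\mathbb{N}$ with $b<2N$, and let $$S=\{-N-Kb,\dots,-N-b,-N\}\cup\{N,N+b,\dots,N+Kb\}\subset\mathbb{Z}.$$ Then $$M(S)=\frac{K+1}{bK+2N}.$$
   Context: For a finite set $S\subset\mathbb{Z}$ with $0\notin S$, define $$M(S):=\sup_{f}\ \sup_{I}\,|I|,$$ where the first supremum is over all real-valued trigonometric polynomials $f(t)=\sum_{\lambda}\hat f(\lambda)e^{2\pi i\lambda t}$ on $\mathbb{R}/\mathbb{Z}$ whose spectrum $\operatorname{spec} f=\{\lambda\in\mathbb{Z}:\hat f(\lambda)\neq 0\}$ (the support of the Fourier transform) is contained in $S$, and the second supremum is over all intervals $I\subset[0,1]$ such that $f$ has no zero on $I$; $|I|$ denotes the length of $I$. $\mathbb{N}$ denotes the positive integers. *)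

theory Defs
  imports "HOL-Analysis.Analysis"
begin

(* Functions on R/Z are represented by functions on the reals; the 1-periodicity of
   trigonometric polynomials follows from the expansion required below. *)

definition fourier_coeff :: "(real \<Rightarrow> real) \<Rightarrow> int \<Rightarrow> complex" where
  "fourier_coeff f n =
     integral {0..1} (\<lambda>t. complex_of_real (f t) * cis (- 2 * pi * real_of_int n * t))"

definition spectrum :: "(real \<Rightarrow> real) \<Rightarrow> int set" where
  "spectrum f = {n. fourier_coeff f n \<noteq> 0}"

definition real_trig_poly :: "(real \<Rightarrow> real) \<Rightarrow> bool" where
  "real_trig_poly f \<longleftrightarrow> finite (spectrum f) \<and>
     (\<forall>t. complex_of_real (f t) =
            (\<Sum>n\<in>spectrum f. fourier_coeff f n * cis (2 * pi * real_of_int n * t)))"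

(* Intervals may be open, closed, half-open or degenerate. All lengths involved lie
   in [0,1], and both families are nonempty (the zero polynomial, the empty interval),
   so the suprema in the reals are genuine ones. *)

definition zero_free_sup :: "int set \<Rightarrow> real" where
  "zero_free_sup S =
     (SUP f\<in>{f. real_trig_poly f \<and> spectrum f \<subseteq> S}.
        SUP I\<in>{I. is_interval I \<and> I \<subseteq> {0..1} \<and> (\<forall>t\<in>I. f t \<noteq> 0)}. measure lborel I)"

end

theory Submission
  imports Defs
begin

text \<open>
  Put \<open>M = b * K + 2 * N\<close> and \<open>L = (K + 1) / M\<close>.  Both bounds rest on the grid of step \<open>1 / M\<close>.
  The positive frequencies \<open>N + k * b\<close> are symmetric about \<open>M / 2\<close>, so an \<open>f\<close> with spectrum in \<open>S\<close>
  is an oscillation \<open>cis (pi * M * t)\<close> times a trigonometric polynomial of degree \<open>K\<close> in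
  \<open>cis (2 * pi * b * t)\<close> (up to a centring factor), plus the complex conjugate.

  Upper bound.  On \<open>K + 2\<close> consecutive points of step \<open>1 / M\<close>, which span length \<open>L\<close>, there are
  positive weights \<open>w\<^sub>j\<close> with \<open>\<Sum>\<^sub>j w\<^sub>j f(x + j / M) = 0\<close> for every admissible \<open>f\<close>
  (\<open>positive_quadrature\<close>).  They are the coefficients of the polynomial of degree \<open>K + 1\<close> with roots
  \<open>cis (2 * pi * (N + k * b) / M) = - cis ((2 * k - K) * \<psi>)\<close>, where \<open>\<psi> = pi * b / M\<close>; by the
  \<open>q\<close>-binomial theorem these are quotients of sines at multiples of \<open>\<psi>\<close> up to \<open>(K + 1) * \<psi>\<close>, and
  \<open>(K + 1) * \<psi> < pi\<close> says exactly that \<open>b < 2 * N\<close>.  A function of constant sign on an interval longer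
  than \<open>L\<close> contradicts the vanishing of the weighted sum (\<open>zero_free_interval_le\<close>).

  Lower bound.  Multiplying \<open>sin (pi * M * t)\<close> by \<open>\<Prod>\<^sub>k sin (pi * b * (k / M - t))\<close>, \<open>1 \<le> k \<le> K\<close>, doubles
  each zero \<open>k / M\<close> inside \<open>(0, L)\<close> and creates no others there, so the product is nonnegative on
  \<open>(0, L)\<close>.  A small multiple of an admissible function that is positive at these \<open>K\<close> zeros removes
  them on any compact subinterval; the same construction with \<open>cos\<close> and with the half-integer points
  \<open>(k - 1 / 2) / M\<close> supplies that function (\<open>exists_zero_free_interval\<close>).
\<close>

section \<open>Trigonometric polynomials given by an expansion\<close>

lemma has_integral_cis_period:
  fixes k :: int
  shows "((\<lambda>t. cis (2 * pi * of_int k * t)) has_integral (if k = 0 then 1 else 0)) {0..1}"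
proof (cases "k = 0")
  case True
  then show ?thesis
    using has_integral_const_real[of "1::complex" 0 1] by simp
next
  case False
  define c where "c = 2 * pi * of_int k"
  have c0: "c \<noteq> 0" using False by (simp add: c_def)
  have "((\<lambda>t. cis (c * t)) has_integral (cis (c * 1) / (\<i> * c) - cis (c * 0) / (\<i> * c))) {0..1}"
  proof (rule fundamental_theorem_of_calculus)
    fix x :: real assume "x \<in> {0..1}"
    have "((\<lambda>t. exp (\<i> * c * t) / (\<i> * c)) has_field_derivative exp (\<i> * c * of_real x)) (at (of_real x))"
      using c0 by (auto intro!: derivative_eq_intros)
    then have "((\<lambda>t. exp (\<i> * c * of_real t) / (\<i> * c)) has_vector_derivative exp (\<i> * c * of_real x))
        (at x within {0..1})"
      by (rule has_vector_derivative_real_field)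
    then show "((\<lambda>t. cis (c * t) / (\<i> * c)) has_vector_derivative cis (c * x)) (at x within {0..1})"
      by (simp add: cis_conv_exp mult.assoc)
  qed simp
  moreover have "cis (c * 1) = 1"
    using cis_multiple_2pi[of "of_int k"] by (simp add: c_def mult_ac)
  ultimately show ?thesis using False by (simp add: c_def)
qed

lemma fourier_coeff_expansion:
  fixes f :: "real \<Rightarrow> real" and c :: "int \<Rightarrow> complex"
  assumes "finite S"
    and f: "\<And>t. complex_of_real (f t) = (\<Sum>m\<in>S. c m * cis (2 * pi * of_int m * t))"
  shows "fourier_coeff f n = (if n \<in> S then c n else 0)"
proof -
  have "((\<lambda>t. \<Sum>m\<in>S. c m * cis (2 * pi * of_int (m - n) * t)) has_integral
      (\<Sum>m\<in>S. c m * (if m - n = 0 then 1 else 0))) {0..1}"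
    by (intro has_integral_sum assms has_integral_mult_right has_integral_cis_period)
  moreover have "(\<Sum>m\<in>S. c m * (if m - n = 0 then 1 else 0)) = (if n \<in> S then c n else 0)"
    using \<open>finite S\<close> by (simp add: if_distrib cong: if_cong)
  moreover have "(\<Sum>m\<in>S. c m * cis (2 * pi * of_int (m - n) * t))
      = complex_of_real (f t) * cis (- 2 * pi * real_of_int n * t)" for t
    unfolding f sum_distrib_right mult.assoc[of "c _"] cis_mult
    by (intro sum.cong refl arg_cong2[where f = "(*)"] arg_cong[where f = cis])
       (simp add: algebra_simps)
  ultimately show ?thesis
    unfolding fourier_coeff_def by (simp add: integral_unique)
qed

lemma real_trig_poly_expansion:
  fixes f :: "real \<Rightarrow> real" and c :: "int \<Rightarrow> complex"
  assumes "finite S"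
    and f: "\<And>t. complex_of_real (f t) = (\<Sum>m\<in>S. c m * cis (2 * pi * of_int m * t))"
  shows "real_trig_poly f \<and> spectrum f \<subseteq> S"
proof -
  note fc = fourier_coeff_expansion[OF assms]
  have sub: "spectrum f \<subseteq> S" by (auto simp: spectrum_def fc)
  have "complex_of_real (f t) = (\<Sum>n\<in>spectrum f. fourier_coeff f n * cis (2 * pi * real_of_int n * t))" for t
  proof -
    have "(\<Sum>n\<in>spectrum f. fourier_coeff f n * cis (2 * pi * real_of_int n * t))
        = (\<Sum>n\<in>S. fourier_coeff f n * cis (2 * pi * real_of_int n * t))"
      using sub \<open>finite S\<close> by (intro sum.mono_neutral_left) (auto simp: spectrum_def)
    also have "\<dots> = complex_of_real (f t)" unfolding f by (intro sum.cong) (auto simp: fc)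
    finally show ?thesis by simp
  qed
  then show ?thesis
    unfolding real_trig_poly_def using sub finite_subset[OF sub \<open>finite S\<close>] by blast
qed

lemma continuous_on_real_trig_poly:
  assumes "real_trig_poly f"
  shows "continuous_on A f"
proof -
  have "f = (\<lambda>t. Re (\<Sum>n\<in>spectrum f. fourier_coeff f n * cis (2 * pi * real_of_int n * t)))"
    using assms unfolding real_trig_poly_def by (metis Re_complex_of_real)
  moreover have "continuous_on A (\<lambda>t. Re (\<Sum>n\<in>spectrum f. fourier_coeff f n * cis (2 * pi * real_of_int n * t)))"
    by (intro continuous_intros)
  ultimately show ?thesis by metis
qed

section \<open>A positive quadrature annihilating the spectrum\<close>

text \<open>The Gaussian binomial coefficient in its symmetric normalisation at \<open>q = cis \<psi>\<close>: the ordinary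
  binomial coefficient with every factor \<open>m\<close> replaced by \<open>sin (m * \<psi>)\<close>.  The numerator vanishes when
  \<open>n < j\<close>, as it should.\<close>

definition sin_binomial :: "real \<Rightarrow> nat \<Rightarrow> nat \<Rightarrow> real" where
  "sin_binomial \<psi> n j = (\<Prod>i<j. sin ((real n - real i) * \<psi>) / sin ((real i + 1) * \<psi>))"

lemma sin_binomial_0 [simp]: "sin_binomial \<psi> n 0 = 1"
  by (simp add: sin_binomial_def)

lemma sin_binomial_eq_0: "n < j \<Longrightarrow> sin_binomial \<psi> n j = 0"
  by (auto simp: sin_binomial_def intro!: bexI[of _ n])

lemma sin_binomial_pos:
  assumes "0 < \<psi>" "real n * \<psi> < pi" "j \<le> n"
  shows "0 < sin_binomial \<psi> n j"
  unfolding sin_binomial_def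
proof (intro prod_pos ballI divide_pos_pos sin_gt_zero)
  fix i assume "i \<in> {..<j}"
  then have i: "real i + 1 \<le> real n" using \<open>j \<le> n\<close> by (simp add: Suc_le_eq[symmetric])
  show "0 < (real n - real i) * \<psi>" "0 < (real i + 1) * \<psi>"
    using i \<open>0 < \<psi>\<close> by (auto intro!: mult_pos_pos)
  have "(real n - real i) * \<psi> \<le> real n * \<psi>" "(real i + 1) * \<psi> \<le> real n * \<psi>"
    using i \<open>0 < \<psi>\<close> by (auto intro!: mult_right_mono)
  then show "(real n - real i) * \<psi> < pi" "(real i + 1) * \<psi> < pi"
    using assms(2) by linarith+
qed

lemma sin_binomial_pascal:
  assumes "sin ((real j + 1) * \<psi>) \<noteq> 0"
  shows "complex_of_real (sin_binomial \<psi> (Suc n) (Suc j)) =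
    cis ((real j + 1) * \<psi>) * sin_binomial \<psi> n (Suc j) + cis (- ((real n - real j) * \<psi>)) * sin_binomial \<psi> n j"
proof -
  define a b where "a = (real j + 1) * \<psi>" and "b = (real n - real j) * \<psi>"
  have sum: "(real n + 1) * \<psi> = a + b" by (simp add: a_def b_def algebra_simps)
  have 1: "sin_binomial \<psi> n (Suc j) = sin_binomial \<psi> n j * (sin b / sin a)"
    by (simp add: sin_binomial_def a_def b_def)
  have "sin_binomial \<psi> (Suc n) (Suc j)
     = (\<Prod>i<Suc j. sin ((real (Suc n) - real i) * \<psi>)) / (\<Prod>i<Suc j. sin ((real i + 1) * \<psi>))"
    by (simp add: sin_binomial_def prod_dividef)
  also have "(\<Prod>i<Suc j. sin ((real (Suc n) - real i) * \<psi>))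
     = sin (a + b) * (\<Prod>i<j. sin ((real n - real i) * \<psi>))"
    unfolding prod.lessThan_Suc_shift by (simp add: sum[symmetric] add.commute)
  also have "(\<Prod>i<Suc j. sin ((real i + 1) * \<psi>)) = sin a * (\<Prod>i<j. sin ((real i + 1) * \<psi>))"
    by (simp add: a_def mult.commute)
  finally have 2: "sin_binomial \<psi> (Suc n) (Suc j) = sin_binomial \<psi> n j * (sin (a + b) / sin a)"
    by (simp add: sin_binomial_def prod_dividef mult_ac del: prod.lessThan_Suc)
  have a0: "sin a \<noteq> 0" using assms by (simp add: a_def)
  have 3: "complex_of_real (sin (a + b)) = cis a * sin b + cis (- b) * sin a"
    by (simp add: complex_eq_iff sin_add)
  have "complex_of_real (sin_binomial \<psi> (Suc n) (Suc j))
     = sin_binomial \<psi> n j * (complex_of_real (sin (a + b)) / sin a)"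
    by (simp add: 2)
  also have "\<dots> = cis a * (sin_binomial \<psi> n j * (sin b / sin a)) + cis (- b) * sin_binomial \<psi> n j"
    unfolding 3 using a0 by (simp add: field_simps)
  finally show ?thesis unfolding 1 a_def b_def by simp
qed

text \<open>The recursive form of the \<open>q\<close>-binomial theorem: the generating polynomial of row \<open>n + 1\<close> is that of
  row \<open>n\<close> with rotated argument, times one new linear factor.\<close>

lemma sin_binomial_sum_Suc:
  fixes z :: complex
  assumes "\<And>i. i \<le> n \<Longrightarrow> sin ((real i + 1) * \<psi>) \<noteq> 0"
  shows "(\<Sum>j\<le>Suc n. sin_binomial \<psi> (Suc n) j * z ^ j)
    = (1 + z * cis (- (real n * \<psi>))) * (\<Sum>j\<le>n. sin_binomial \<psi> n j * (cis \<psi> * z) ^ j)"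
proof -
  define g where "g j = sin_binomial \<psi> n j * (cis \<psi> * z) ^ j" for j
  have g0: "g 0 = 1" and gS: "g (Suc n) = 0" by (simp_all add: g_def sin_binomial_eq_0)
  have summand: "sin_binomial \<psi> (Suc n) (Suc j) * z ^ Suc j = g (Suc j) + z * cis (- (real n * \<psi>)) * g j"
    if "j \<le> n" for j
  proof -
    have "cis (- ((real n - real j) * \<psi>)) = cis (- (real n * \<psi>)) * cis \<psi> ^ j"
      by (simp add: Complex.DeMoivre cis_mult algebra_simps)
    moreover have "cis ((real j + 1) * \<psi>) = cis \<psi> ^ Suc j"
      by (simp only: Complex.DeMoivre of_nat_Suc)
         (simp add: algebra_simps)
    ultimately show ?thesis
      unfolding sin_binomial_pascal[OF assms[OF that]] g_def
      by (simp add: algebra_simps power_mult_distrib)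
  qed
  have "(\<Sum>j\<le>Suc n. sin_binomial \<psi> (Suc n) j * z ^ j)
     = 1 + (\<Sum>j\<le>n. sin_binomial \<psi> (Suc n) (Suc j) * z ^ Suc j)"
    by (subst sum.atMost_Suc_shift) simp
  also have "\<dots> = 1 + (\<Sum>j\<le>n. g (Suc j)) + z * cis (- (real n * \<psi>)) * (\<Sum>j\<le>n. g j)"
    unfolding sum_distrib_left add.assoc sum.distrib[symmetric]
    by (intro arg_cong2[where f = "(+)"] refl sum.cong summand) simp
  also have "1 + (\<Sum>j\<le>n. g (Suc j)) = (\<Sum>j\<le>n. g j)"
    using sum.atMost_Suc_shift[of g n] by (simp add: g0 gS)
  finally show ?thesis by (simp add: g_def algebra_simps)
qed

text \<open>Row \<open>n\<close> is the coefficient sequence of a polynomial whose roots lie on the unit circle at angles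
  centred at \<open>pi\<close> with spacing \<open>2 * \<psi>\<close>.\<close>

lemma sin_binomial_root:
  assumes "0 < \<psi>" "real n * \<psi> < pi" "k < n"
  shows "(\<Sum>j\<le>n. sin_binomial \<psi> n j * (- cis ((2 * real k - real n + 1) * \<psi>)) ^ j) = 0"
  using assms(2,3)
proof (induction n arbitrary: k)
  case (Suc n)
  have nz: "sin ((real i + 1) * \<psi>) \<noteq> 0" if "i \<le> n" for i
  proof -
    have "(real i + 1) * \<psi> \<le> real (Suc n) * \<psi>" using that \<open>0 < \<psi>\<close> by (intro mult_right_mono) auto
    then show ?thesis
      using Suc.prems(1) \<open>0 < \<psi>\<close> sin_gt_zero[of "(real i + 1) * \<psi>"] by (smt (verit) mult_pos_pos of_nat_0_le_iff)
  qed
  note step = sin_binomial_sum_Suc[OF nz]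
  show ?case
  proof (cases "k = n")
    case True
    have "1 + - cis ((2 * real k - real (Suc n) + 1) * \<psi>) * cis (- (real n * \<psi>)) = 0"
      by (simp add: True cis_mult algebra_simps)
    then show ?thesis by (subst step) auto
  next
    case False
    then have "k < n" using Suc.prems by simp
    have "cis \<psi> * - cis ((2 * real k - real (Suc n) + 1) * \<psi>) = - cis ((2 * real k - real n + 1) * \<psi>)"
      by (simp add: cis_mult algebra_simps)
    moreover have "real n * \<psi> < pi" using Suc.prems(1) \<open>0 < \<psi>\<close> by (simp add: algebra_simps)
    ultimately show ?thesis using Suc.IH[OF _ \<open>k < n\<close>] by (subst step) auto
  qed
qed simp

text \<open>The weights are independent of the base point: a translation of the nodes multiplies each character
  by a constant.  They annihilate the characters in \<open>S\<close>, hence every polynomial with spectrum in \<open>S\<close>.\<close>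

lemma positive_quadrature:
  fixes N K b :: nat and S :: "int set"
  assumes "0 < b" "b < 2 * N"
    and S: "S = (\<lambda>k. - int N - int k * int b) ` {0..K} \<union> (\<lambda>k. int N + int k * int b) ` {0..K}"
    and M_def: "M = real b * real K + 2 * real N"
  shows "\<exists>w :: nat \<Rightarrow> real. (\<forall>j\<le>Suc K. (0::real) < w j) \<and>
    (\<forall>n\<in>S. (\<Sum>j\<le>Suc K. w j * cis (2 * pi * of_int n * (real j / M))) = 0)"
proof (intro exI conjI allI ballI impI)
  define \<psi> where "\<psi> = pi * b / M"
  have M: "0 < M" using assms by (auto simp: M_def intro!: add_nonneg_pos)
  have \<psi>: "0 < \<psi>" using assms M by (simp add: \<psi>_def)
  \<comment> \<open>Here \<open>b < 2 * N\<close> enters: it bounds \<open>(K + 1) * \<psi>\<close> by \<open>pi\<close>, so that the sines in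
    the weights are positive.\<close>
  have "real (Suc K) * real b < M" using \<open>b < 2 * N\<close> by (simp add: M_def algebra_simps)
  then have small: "real (Suc K) * \<psi> < pi"
    using M by (simp add: \<psi>_def pos_divide_less_eq mult.left_commute)
  show "0 < sin_binomial \<psi> (Suc K) j" if "j \<le> Suc K" for j
    using sin_binomial_pos[OF \<psi> small that] .
  fix n assume "n \<in> S"
  \<comment> \<open>Shifting by \<open>1 / M\<close> turns the frequencies into the roots \<open>- cis ((2 * k - K) * \<psi>)\<close>,
    a set closed under conjugation.\<close>
  have "\<exists>k\<le>K. cis (2 * pi * of_int n / M) = - cis ((2 * real k - real K) * \<psi>)"
    using \<open>n \<in> S\<close> unfolding S
  proof
    assume "n \<in> (\<lambda>k. int N + int k * int b) ` {0..K}"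
    then obtain k where k: "k \<le> K" "n = int N + int k * int b" by auto
    have "2 * pi * of_int n / M = (2 * real k - real K) * \<psi> + pi"
      using M by (simp add: k \<psi>_def field_simps) (simp add: M_def algebra_simps)
    then show ?thesis using k(1) by (auto simp: cis_mult[symmetric] intro!: exI[of _ k])
  next
    assume "n \<in> (\<lambda>k. - int N - int k * int b) ` {0..K}"
    then obtain k where k: "k \<le> K" "n = - int N - int k * int b" by auto
    have "2 * pi * of_int n / M = (2 * real (K - k) - real K) * \<psi> + - pi"
      using M k(1) by (simp add: k \<psi>_def of_nat_diff field_simps) (simp add: M_def algebra_simps)
    moreover have "cis (- pi) = - 1" by (simp add: complex_eq_iff)
    ultimately show ?thesis using k(1)
      by (auto simp: cis_mult[symmetric] simp del: add_uminus_conv_diff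
          intro!: exI[of _ "K - k"])
  qed
  then obtain k where k: "k \<le> K" "cis (2 * pi * of_int n / M) = - cis ((2 * real k - real K) * \<psi>)"
    by blast
  have "cis (2 * pi * of_int n * (real j / M)) = (- cis ((2 * real k - real (Suc K) + 1) * \<psi>)) ^ j" for j
  proof -
    have "cis (2 * pi * of_int n * (real j / M)) = cis (2 * pi * of_int n / M) ^ j"
      unfolding Complex.DeMoivre by (simp add: field_simps)
    then show ?thesis using k(2) by simp
  qed
  then show "(\<Sum>j\<le>Suc K. sin_binomial \<psi> (Suc K) j * cis (2 * pi * of_int n * (real j / M))) = 0"
    using sin_binomial_root[OF \<psi> small, of k] k(1) by simp
qed

section \<open>The upper bound\<close>

lemma exists_subinterval_of_measure:
  fixes I :: "real set"
  assumes "is_interval I" "I \<subseteq> {0..1}" "0 \<le> l" "l < measure lborel I"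
  obtains x where "{x..x + l} \<subseteq> I"
proof -
  have ne: "I \<noteq> {}" using assms by auto
  have bdd: "bdd_below I" "bdd_above I"
    using bdd_below_mono[OF bdd_below_Icc assms(2)] bdd_above_mono[OF bdd_above_Icc assms(2)] .
  have le: "Inf I \<le> Sup I" using ne bdd by (simp add: cInf_le_cSup)
  have "I \<subseteq> {Inf I..Sup I}" using bdd by (auto intro: cInf_lower cSup_upper)
  \<comment> \<open>A non-measurable set would have measure \<open>0\<close> by convention.\<close>
  moreover have "I \<in> sets lborel"
    using assms(3,4) measure_notin_sets[of I lborel] by fastforce
  moreover have "{Inf I..Sup I} \<in> fmeasurable lborel"
    using le by (intro fmeasurableI) simp_all
  ultimately have "measure lborel I \<le> measure lborel {Inf I..Sup I}"
    by (intro measure_mono_fmeasurable)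
  then have "Inf I + l < Sup I" using assms(4) le by simp
  then obtain y where y: "y \<in> I" "Inf I + l < y"
    using less_cSup_iff[OF ne bdd(2)] by blast
  then have "Inf I < y - l" by simp
  then obtain x where x: "x \<in> I" "x < y - l"
    using cInf_less_iff[OF ne bdd(1)] by blast
  have "{x..x + l} \<subseteq> {x..y}" using x by auto
  also have "\<dots> \<subseteq> I" using mem_is_interval_1_I[OF assms(1) x(1) y(1)] by auto
  finally show ?thesis by (rule that)
qed

lemma zero_free_interval_le:
  fixes N K b :: nat and S :: "int set"
  assumes "0 < b" "b < 2 * N"
    and S: "S = (\<lambda>k. - int N - int k * int b) ` {0..K} \<union> (\<lambda>k. int N + int k * int b) ` {0..K}"
    and f: "real_trig_poly f" "spectrum f \<subseteq> S"
    and I: "is_interval I" "I \<subseteq> {0..1}" "\<And>t. t \<in> I \<Longrightarrow> f t \<noteq> 0"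
  shows "measure lborel I \<le> (real K + 1) / (real b * real K + 2 * real N)"
proof (rule ccontr)
  define M where "M = real b * real K + 2 * real N"
  have M: "0 < M" using assms by (auto simp: M_def intro!: add_nonneg_pos)
  assume "\<not> ?thesis"
  then have "(real K + 1) / M < measure lborel I" by (simp add: M_def)
  moreover have "0 \<le> (real K + 1) / M" using M by simp
  ultimately obtain x where x: "{x..x + (real K + 1) / M} \<subseteq> I"
    using exists_subinterval_of_measure[OF I(1,2)] by metis
  obtain w :: "nat \<Rightarrow> real" where w: "\<forall>j\<le>Suc K. (0::real) < w j"
    and w0: "\<forall>n\<in>S. (\<Sum>j\<le>Suc K. w j * cis (2 * pi * of_int n * (real j / M))) = 0"
    using positive_quadrature[OF assms(1,2) S M_def] by (elim exE conjE)
  define p where "p j = x + real j / M" for j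
  have p: "p j \<in> I" if "j \<le> Suc K" for j
  proof -
    have "real j / M \<le> (real K + 1) / M" using that M by (intro divide_right_mono) auto
    then show ?thesis using x M by (auto simp: p_def)
  qed
  have "complex_of_real (\<Sum>j\<le>Suc K. w j * f (p j))
     = (\<Sum>j\<le>Suc K. \<Sum>n\<in>spectrum f. w j * (fourier_coeff f n * cis (2 * pi * of_int n * p j)))"
    using f(1) by (simp add: real_trig_poly_def sum_distrib_left del: sum.atMost_Suc)
  also have "\<dots> = (\<Sum>n\<in>spectrum f. \<Sum>j\<le>Suc K. w j * (fourier_coeff f n * cis (2 * pi * of_int n * p j)))"
    by (rule sum.swap)
  also have "\<dots> = (\<Sum>n\<in>spectrum f. fourier_coeff f n * cis (2 * pi * of_int n * x) *
      (\<Sum>j\<le>Suc K. w j * cis (2 * pi * of_int n * (real j / M))))"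
    unfolding sum_distrib_left
  proof (intro sum.cong refl)
    fix n :: int and j
    have "cis (2 * pi * of_int n * p j) = cis (2 * pi * of_int n * x) * cis (2 * pi * of_int n * (real j / M))"
      by (simp only: p_def distrib_left cis_mult)
    then show "w j * (fourier_coeff f n * cis (2 * pi * of_int n * p j))
      = fourier_coeff f n * cis (2 * pi * of_int n * x) * (w j * cis (2 * pi * of_int n * (real j / M)))"
      by (simp only: mult_ac)
  qed
  also have "\<dots> = 0"
  proof (intro sum.neutral ballI)
    fix n assume "n \<in> spectrum f"
    then have "n \<in> S" using f(2) by blast
    then show "fourier_coeff f n * cis (2 * pi * of_int n * x) *
      (\<Sum>j\<le>Suc K. w j * cis (2 * pi * of_int n * (real j / M))) = 0"
      by (simp only: w0 mult_zero_right)
  qed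
  finally have sum0: "(\<Sum>j\<le>Suc K. w j * f (p j)) = 0" unfolding of_real_eq_0_iff .
  \<comment> \<open>The weights being positive, \<open>f\<close> takes both signs (or a zero) at the nodes.\<close>
  obtain i where i: "i \<le> Suc K" "f (p i) \<le> 0"
  proof (rule ccontr)
    assume "\<not> thesis"
    then have "\<forall>j\<le>Suc K. 0 < f (p j)" using that by force
    then have "0 < (\<Sum>j\<le>Suc K. w j * f (p j))" using w by (intro sum_pos) auto
    then show False using sum0 by simp
  qed
  obtain j where j: "j \<le> Suc K" "0 \<le> f (p j)"
  proof (rule ccontr)
    assume "\<not> thesis"
    then have "\<forall>j\<le>Suc K. f (p j) < 0" using that by force
    then have "0 < (\<Sum>j\<le>Suc K. - (w j * f (p j)))" using w
      by (intro sum_pos) (auto simp: mult_pos_neg)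
    then show False using sum0 by (simp add: sum_negf del: sum.atMost_Suc)
  qed
  have "connected (f ` I)"
    using I(1) f(1) by (intro connected_continuous_image continuous_on_real_trig_poly is_interval_connected)
  then have "{f (p i)..f (p j)} \<subseteq> f ` I"
    using p i j by (intro connected_contains_Icc) auto
  then have "0 \<in> f ` I" using i j by (meson atLeastAtMost_iff subsetD)
  then show False using I(3) by auto
qed

section \<open>Polynomials with long zero-free intervals\<close>

lemma prod_sin_expansion:
  fixes a :: real and d :: "nat \<Rightarrow> real"
  shows "\<exists>p :: nat \<Rightarrow> complex. \<forall>t. complex_of_real (\<Prod>k<n. sin (d k - a * t))
    = (\<Sum>k\<le>n. p k * cis ((2 * real k - real n) * a * t))"
proof (induction n)
  case 0
  show ?case by (rule exI[of _ "\<lambda>_. 1"]) simp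
next
  case (Suc n)
  then obtain p where p: "complex_of_real (\<Prod>k<n. sin (d k - a * t))
    = (\<Sum>k\<le>n. p k * cis ((2 * real k - real n) * a * t))" for t by blast
  define u v where "u = \<i> / 2 * cis (- d n)" and "v = - \<i> / 2 * cis (d n)"
  have sin: "complex_of_real (sin (d n - a * t)) = u * cis (a * t) + v * cis (- (a * t))" for t
  proof -
    have "u * cis (a * t) = \<i> / 2 * cis (- (d n - a * t))" "v * cis (- (a * t)) = - \<i> / 2 * cis (d n - a * t)"
      by (simp_all add: u_def v_def mult.assoc cis_mult)
    moreover have "complex_of_real (sin y) = \<i> / 2 * cis (- y) + - \<i> / 2 * cis y" for y
      by (simp add: complex_eq_iff)
    ultimately show ?thesis by (simp only:)
  qed
  define q where "q k = (if k = 0 then 0 else u * p (k - 1)) + (if k = Suc n then 0 else v * p k)" for k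
  have "complex_of_real (\<Prod>k<Suc n. sin (d k - a * t))
    = (\<Sum>k\<le>Suc n. q k * cis ((2 * real k - real (Suc n)) * a * t))" for t
  proof -
    let ?e = "\<lambda>k. cis ((2 * real k - real (Suc n)) * a * t)"
    have "(\<Sum>k\<le>Suc n. q k * ?e k)
      = (\<Sum>k\<le>Suc n. (if k = 0 then 0 else u * p (k - 1)) * ?e k) + (\<Sum>k\<le>Suc n. (if k = Suc n then 0 else v * p k) * ?e k)"
      by (simp only: q_def distrib_right sum.distrib)
    also have "(\<Sum>k\<le>Suc n. (if k = 0 then 0 else u * p (k - 1)) * ?e k) = (\<Sum>k\<le>n. u * p k * ?e (Suc k))"
      by (subst sum.atMost_Suc_shift) simp
    also have "\<dots> = (\<Sum>k\<le>n. p k * cis ((2 * real k - real n) * a * t)) * (u * cis (a * t))"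
      unfolding sum_distrib_right
    proof (intro sum.cong refl)
      fix k
      have "?e (Suc k) = cis ((2 * real k - real n) * a * t) * cis (a * t)"
        by (simp add: cis_mult algebra_simps)
      then show "u * p k * ?e (Suc k) = p k * cis ((2 * real k - real n) * a * t) * (u * cis (a * t))" by simp
    qed
    also have "(\<Sum>k\<le>Suc n. (if k = Suc n then 0 else v * p k) * ?e k) = (\<Sum>k\<le>n. v * p k * ?e k)"
      by simp
    also have "\<dots> = (\<Sum>k\<le>n. p k * cis ((2 * real k - real n) * a * t)) * (v * cis (- (a * t)))"
      unfolding sum_distrib_right
    proof (intro sum.cong refl)
      fix k
      have "?e k = cis ((2 * real k - real n) * a * t) * cis (- (a * t))"
        by (simp add: cis_mult algebra_simps)
      then show "v * p k * ?e k = p k * cis ((2 * real k - real n) * a * t) * (v * cis (- (a * t)))" by simp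
    qed
    finally show ?thesis by (simp only: prod.lessThan_Suc of_real_mult p sin distrib_left)
  qed
  then show ?case by blast
qed

text \<open>Modulating a product of \<open>K\<close> sines of frequency \<open>b / 2\<close> by frequency \<open>M / 2\<close> lands exactly in the
  prescribed spectrum, because \<open>M / 2 + (2 * k - K) * b / 2 = N + k * b\<close>.\<close>

lemma modulated_prod_sin_expansion:
  fixes N K b :: nat and S :: "int set" and d :: "nat \<Rightarrow> real" and \<alpha> \<beta> :: complex
  assumes "0 < N" "0 < b"
    and S: "S = (\<lambda>k. - int N - int k * int b) ` {0..K} \<union> (\<lambda>k. int N + int k * int b) ` {0..K}"
  defines "M \<equiv> real b * real K + 2 * real N"
  shows "\<exists>c. \<forall>t. (\<alpha> * cis (pi * M * t) + \<beta> * cis (- (pi * M * t))) * complex_of_real (\<Prod>k<K. sin (d k - pi * b * t))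
    = (\<Sum>n\<in>S. c n * cis (2 * pi * of_int n * t))"
proof -
  obtain p where p: "complex_of_real (\<Prod>k<K. sin (d k - pi * b * t))
    = (\<Sum>k\<le>K. p k * cis ((2 * real k - real K) * (pi * b) * t))" for t
    using prod_sin_expansion[where n = K and d = d and a = "pi * b"] by auto
  \<comment> \<open>The coefficient \<open>p k\<close> moves to \<open>N + k * b\<close> and, under the opposite modulation, to
    \<open>- N - (K - k) * b\<close>.\<close>
  define c where "c n = (if n > 0 then \<alpha> * p (nat ((n - int N) div int b))
      else \<beta> * p (K - nat ((- n - int N) div int b)))" for n
  have c1: "c (int N + int k * int b) = \<alpha> * p k" for k
    using assms by (simp add: c_def add_pos_nonneg)
  have c2: "c (- int N - int k * int b) = \<beta> * p (K - k)" for k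
    using assms by (auto simp: c_def) (smt (verit) mult_nonneg_nonneg of_nat_0_le_iff of_nat_0_less_iff)
  have "(\<alpha> * cis (pi * M * t) + \<beta> * cis (- (pi * M * t))) * complex_of_real (\<Prod>k<K. sin (d k - pi * b * t))
    = (\<Sum>n\<in>S. c n * cis (2 * pi * of_int n * t))" for t
  proof -
    let ?e = "\<lambda>n::int. cis (2 * pi * of_int n * t)"
    have "(\<Sum>n\<in>S. c n * ?e n) = (\<Sum>n\<in>(\<lambda>k. - int N - int k * int b) ` {0..K}. c n * ?e n)
        + (\<Sum>n\<in>(\<lambda>k. int N + int k * int b) ` {0..K}. c n * ?e n)"
      unfolding S
    proof (rule sum.union_disjoint)
      have "- int N - int k * int b \<noteq> int N + int l * int b" for k l :: nat
        using \<open>0 < N\<close> by (smt (verit) mult_nonneg_nonneg of_nat_0_le_iff of_nat_0_less_iff)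
      then show "(\<lambda>k. - int N - int k * int b) ` {0..K} \<inter> (\<lambda>k. int N + int k * int b) ` {0..K} = {}"
        by auto
    qed auto
    also have "(\<Sum>n\<in>(\<lambda>k. int N + int k * int b) ` {0..K}. c n * ?e n)
        = (\<Sum>k\<in>{0..K}. \<alpha> * p k * ?e (int N + int k * int b))"
      using \<open>0 < b\<close> by (subst sum.reindex) (auto simp: inj_on_def c1)
    also have "\<dots> = \<alpha> * cis (pi * M * t) * (\<Sum>k\<le>K. p k * cis ((2 * real k - real K) * (pi * b) * t))"
      unfolding sum_distrib_left atLeast0AtMost
    proof (intro sum.cong refl)
      fix k
      have "?e (int N + int k * int b) = cis (pi * M * t) * cis ((2 * real k - real K) * (pi * b) * t)"
        by (simp add: cis_mult M_def algebra_simps)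
      then show "\<alpha> * p k * ?e (int N + int k * int b)
          = \<alpha> * cis (pi * M * t) * (p k * cis ((2 * real k - real K) * (pi * b) * t))" by simp
    qed
    also have "(\<Sum>n\<in>(\<lambda>k. - int N - int k * int b) ` {0..K}. c n * ?e n)
        = (\<Sum>k\<in>{0..K}. \<beta> * p (K - k) * ?e (- int N - int k * int b))"
      using \<open>0 < b\<close> by (subst sum.reindex) (auto simp: inj_on_def c2)
    also have "\<dots> = (\<Sum>k\<in>{0..K}. \<beta> * p k * ?e (- int N - int (K - k) * int b))"
      by (subst sum.atLeastAtMost_rev) simp
    also have "\<dots> = \<beta> * cis (- (pi * M * t)) * (\<Sum>k\<le>K. p k * cis ((2 * real k - real K) * (pi * b) * t))"
      unfolding sum_distrib_left atLeast0AtMost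
    proof (intro sum.cong refl)
      fix k assume "k \<in> {..K}"
      then have "?e (- int N - int (K - k) * int b) = cis (- (pi * M * t)) * cis ((2 * real k - real K) * (pi * b) * t)"
        by (simp add: cis_mult M_def of_nat_diff algebra_simps)
      then show "\<beta> * p k * ?e (- int N - int (K - k) * int b)
          = \<beta> * cis (- (pi * M * t)) * (p k * cis ((2 * real k - real K) * (pi * b) * t))" by simp
    qed
    finally show ?thesis unfolding p by (simp add: algebra_simps)
  qed
  then show ?thesis by blast
qed

lemma minus_one_power_prod_pos:
  fixes y :: "nat \<Rightarrow> real"
  assumes "j \<le> K" "\<And>k. k < j \<Longrightarrow> y k < 0" "\<And>k. j \<le> k \<Longrightarrow> k < K \<Longrightarrow> 0 < y k"
  shows "0 < (- 1) ^ j * (\<Prod>k<K. y k)"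
proof -
  have "{..<K} = {..<j} \<union> {j..<K}" using assms(1) by auto
  then have "(\<Prod>k<K. y k) = (\<Prod>k<j. y k) * (\<Prod>k\<in>{j..<K}. y k)"
    by (simp add: prod.union_disjoint ivl_disj_int)
  then have "(- 1) ^ j * (\<Prod>k<K. y k) = (\<Prod>k<j. - y k) * (\<Prod>k\<in>{j..<K}. y k)"
    by (simp add: prod_uminus)
  also have "\<dots> > 0" using assms by (intro mult_pos_pos prod_pos) auto
  finally show ?thesis .
qed

text \<open>The nodes \<open>k + \<sigma>\<close> and the point \<open>x\<close> all lie in \<open>[0, K + 1]\<close>, where \<open>\<psi>\<close> times a difference stays
  inside \<open>(- pi, pi)\<close>; so each sine has the sign of its argument and the product changes sign
  once for each of the \<open>j\<close> nodes below \<open>x\<close>.\<close>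

lemma prod_sin_sign:
  fixes \<psi> \<sigma> x :: real
  assumes "0 < \<psi>" "(real K + 1) * \<psi> < pi" and "0 \<le> \<sigma>" "\<sigma> \<le> 1" "0 < x" "x < real K + 1" "j \<le> K"
    and "\<And>k. k < j \<Longrightarrow> real k + \<sigma> < x" "\<And>k. j \<le> k \<Longrightarrow> x < real k + \<sigma>"
  shows "0 < (- 1) ^ j * (\<Prod>k<K. sin (\<psi> * (real k + \<sigma>) - \<psi> * x))"
proof (rule minus_one_power_prod_pos)
  fix k assume "k < j"
  then have "\<psi> * (real k + \<sigma>) < \<psi> * x" using assms by simp
  moreover have "\<psi> * x < \<psi> * (real K + 1)" "0 \<le> \<psi> * (real k + \<sigma>)" using assms by simp_all
  moreover have "\<psi> * (real K + 1) < pi" using assms by (simp add: mult.commute)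
  ultimately have "0 < sin (- (\<psi> * (real k + \<sigma>) - \<psi> * x))"
    by (intro sin_gt_zero) linarith+
  then show "sin (\<psi> * (real k + \<sigma>) - \<psi> * x) < 0" by (simp only: sin_minus)
next
  fix k assume k: "j \<le> k" "k < K"
  then have "\<psi> * x < \<psi> * (real k + \<sigma>)" using assms by simp
  moreover have "\<psi> * (real k + \<sigma>) \<le> \<psi> * (real K + 1)" "0 < \<psi> * x" using assms k by simp_all
  moreover have "\<psi> * (real K + 1) < pi" using assms by (simp add: mult.commute)
  ultimately show "0 < sin (\<psi> * (real k + \<sigma>) - \<psi> * x)"
    by (intro sin_gt_zero) linarith+
qed (use assms in auto)

lemma sin_prod_pos:
  fixes \<psi> x :: real
  assumes "0 < \<psi>" "(real K + 1) * \<psi> < pi" "0 < x" "x < real K + 1" "x \<notin> \<int>"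
  shows "0 < sin (pi * x) * (\<Prod>k<K. sin (\<psi> * (real k + 1) - \<psi> * x))"
proof -
  define j where "j = nat \<lfloor>x\<rfloor>"
  have jx: "real j < x" "x < real j + 1"
  proof -
    have "real j = of_int \<lfloor>x\<rfloor>" using \<open>0 < x\<close> by (simp add: j_def)
    moreover have "of_int \<lfloor>x\<rfloor> \<noteq> x" using \<open>x \<notin> \<int>\<close> by (metis Ints_of_int)
    ultimately show "real j < x" "x < real j + 1" by linarith+
  qed
  have "0 < sin (pi * (x - real j))" using jx by (intro sin_gt_zero) auto
  also have "sin (pi * (x - real j)) = (- 1) ^ j * sin (pi * x)"
    by (simp add: right_diff_distrib sin_diff mult.commute[of pi "real j"])
  finally have 1: "0 < (- 1) ^ j * sin (pi * x)" .
  have 2: "0 < (- 1) ^ j * (\<Prod>k<K. sin (\<psi> * (real k + 1) - \<psi> * x))"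
    using assms jx by (intro prod_sin_sign) auto
  have "0 < ((- 1) ^ j * sin (pi * x)) * ((- 1) ^ j * (\<Prod>k<K. sin (\<psi> * (real k + 1) - \<psi> * x)))"
    using 1 2 by (rule mult_pos_pos)
  also have "\<dots> = ((- 1) ^ j * (- 1) ^ j) * (sin (pi * x) * (\<Prod>k<K. sin (\<psi> * (real k + 1) - \<psi> * x)))"
    by (simp only: mult_ac)
  also have "(- 1 :: real) ^ j * (- 1) ^ j = 1" by (simp flip: power_mult_distrib)
  finally show ?thesis by simp
qed

lemma cos_prod_pos:
  fixes \<psi> :: real
  assumes "0 < \<psi>" "(real K + 1) * \<psi> < pi" "0 < j" "j \<le> K"
  shows "0 < cos (pi * real j) * (\<Prod>k<K. sin (\<psi> * (real k + 1 / 2) - \<psi> * real j))"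
proof -
  have "0 < (- 1) ^ j * (\<Prod>k<K. sin (\<psi> * (real k + 1 / 2) - \<psi> * real j))"
    using assms by (intro prod_sin_sign) auto
  then show ?thesis by (simp add: mult.commute[of pi])
qed

text \<open>Away from \<open>{g > 0}\<close> the function \<open>f\<close> is bounded below by a positive constant, so a small
  multiple of \<open>g\<close> cannot destroy its positivity there.\<close>

lemma compact_perturbation_pos:
  fixes f g :: "'a::t2_space \<Rightarrow> real"
  assumes "compact J" "continuous_on J f" "continuous_on J g"
    and pos: "\<And>t. t \<in> J \<Longrightarrow> 0 < f t \<or> f t = 0 \<and> 0 < g t"
  obtains \<epsilon> where "0 < \<epsilon>" "\<And>t. t \<in> J \<Longrightarrow> 0 < f t + \<epsilon> * g t"
proof -
  define Z where "Z = J \<inter> g -` {..0}"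
  show ?thesis
  proof (cases "Z = {}")
    case True
    have "0 < f t + 1 * g t" if "t \<in> J" for t
      using pos[OF that] True that by (force simp: Z_def)
    then show ?thesis using that[of 1] by simp
  next
    case False
    have "closed Z"
      unfolding Z_def using assms(1,3) by (intro continuous_closed_preimage) (auto intro: compact_imp_closed)
    then have "compact Z"
      using compact_Int_closed[OF \<open>compact J\<close>] by (metis Z_def inf.absorb_iff2 inf_le1)
    have cf: "continuous_on Z f" and cg: "continuous_on Z g"
      using assms by (auto simp: Z_def intro: continuous_on_subset)
    obtain a where a: "a \<in> Z" "\<And>t. t \<in> Z \<Longrightarrow> f a \<le> f t"
      using continuous_attains_inf[OF \<open>compact Z\<close> False cf] by blast
    obtain c where c: "c \<in> Z" "\<And>t. t \<in> Z \<Longrightarrow> g c \<le> g t"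
      using continuous_attains_inf[OF \<open>compact Z\<close> False cg] by blast
    have fa: "0 < f a" using a(1) pos[of a] by (auto simp: Z_def)
    have gc: "g c \<le> 0" using c(1) by (auto simp: Z_def)
    define \<epsilon> where "\<epsilon> = f a / (1 - g c)"
    have \<epsilon>: "0 < \<epsilon>" using fa gc by (simp add: \<epsilon>_def)
    have "0 < f t + \<epsilon> * g t" if "t \<in> J" for t
    proof (cases "t \<in> Z")
      case True
      have "\<epsilon> * (1 - g c) = f a" using gc by (simp add: \<epsilon>_def)
      then have "0 < f a + \<epsilon> * g c" using \<epsilon> by (simp add: algebra_simps)
      also have "\<dots> \<le> f t + \<epsilon> * g t"
        using a(2)[OF True] c(2)[OF True] \<epsilon> by (intro add_mono mult_left_mono) auto
      finally show ?thesis .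
    next
      case False
      then have "0 < g t" using that by (auto simp: Z_def)
      then show ?thesis using pos[OF that] \<epsilon> by (auto intro: add_pos_pos)
    qed
    then show ?thesis using that \<epsilon> by blast
  qed
qed

text \<open>In the variable \<open>x = M * t\<close> the unperturbed function is positive on \<open>(0, K + 1)\<close> except for double
  zeros at the integers, where its perturbation is positive.\<close>

lemma exists_zero_free_interval:
  fixes N K b :: nat and S :: "int set"
  assumes "0 < N" "0 < b" "b < 2 * N"
    and S: "S = (\<lambda>k. - int N - int k * int b) ` {0..K} \<union> (\<lambda>k. int N + int k * int b) ` {0..K}"
    and \<delta>: "0 < \<delta>"
  defines "L \<equiv> (real K + 1) / (real b * real K + 2 * real N)"
  obtains f where "real_trig_poly f" "spectrum f \<subseteq> S" "\<And>t. t \<in> {\<delta>..L - \<delta>} \<Longrightarrow> f t \<noteq> 0"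
proof -
  define M where "M = real b * real K + 2 * real N"
  define \<psi> where "\<psi> = pi * b / M"
  have M: "0 < M" using assms by (auto simp: M_def intro!: add_nonneg_pos)
  have \<psi>: "0 < \<psi>" using assms M by (simp add: \<psi>_def)
  have \<psi>M: "pi * (real b * t) = \<psi> * (M * t)" for t using M by (simp add: \<psi>_def)
  have "(real K + 1) * real b < M" using \<open>b < 2 * N\<close> by (simp add: M_def algebra_simps)
  then have small: "(real K + 1) * \<psi> < pi"
    using M by (simp add: \<psi>_def pos_divide_less_eq mult.left_commute)
  define P where "P \<sigma> t = (\<Prod>k<K. sin (\<psi> * (real k + \<sigma>) - pi * b * t))" for \<sigma> t
  define f where "f t = sin (pi * M * t) * P 1 t" for t
  define g where "g t = cos (pi * M * t) * P (1 / 2) t" for t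
  have dich: "0 < f t \<or> f t = 0 \<and> 0 < g t" if "t \<in> {\<delta>..L - \<delta>}" for t
  proof -
    have "0 < t" "t < (real K + 1) / M" using that \<delta> by (auto simp: L_def M_def)
    then have x: "0 < M * t" "M * t < real K + 1"
      using M by (auto simp: pos_less_divide_eq mult.commute)
    show ?thesis
    proof (cases "M * t \<in> \<int>")
      case False
      then show ?thesis
        using sin_prod_pos[OF \<psi> small x] by (simp add: f_def P_def \<psi>M mult.assoc)
    next
      case True
      then obtain i where i: "M * t = of_int i" by (elim Ints_cases)
      define j where "j = nat i"
      have j: "M * t = real j" using i x(1) by (simp add: j_def)
      have "0 < j" "j \<le> K" using x by (auto simp: j)
      then have "0 < g t" using cos_prod_pos[OF \<psi> small]
        by (simp add: g_def P_def \<psi>M mult.assoc j)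
      moreover have "sin (pi * (M * t)) = 0" unfolding j by (simp add: mult.commute[of pi])
      ultimately show ?thesis by (simp add: f_def mult.assoc)
    qed
  qed
  have "continuous_on {\<delta>..L - \<delta>} f" "continuous_on {\<delta>..L - \<delta>} g"
    unfolding f_def g_def P_def by (intro continuous_intros)+
  then obtain \<epsilon> where \<epsilon>: "0 < \<epsilon>" "\<And>t. t \<in> {\<delta>..L - \<delta>} \<Longrightarrow> 0 < f t + \<epsilon> * g t"
    using compact_perturbation_pos[of "{\<delta>..L - \<delta>}" f g] dich by auto
  obtain c1 where c1: "(- \<i> / 2 * cis (pi * M * t) + \<i> / 2 * cis (- (pi * M * t))) * complex_of_real (P 1 t)
    = (\<Sum>n\<in>S. c1 n * cis (2 * pi * of_int n * t))" for t
    using modulated_prod_sin_expansion[OF assms(1,2) S, of "- \<i> / 2" "\<i> / 2" "\<lambda>k. \<psi> * (real k + 1)"]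
    unfolding P_def M_def by blast
  obtain c2 where c2: "(1 / 2 * cis (pi * M * t) + 1 / 2 * cis (- (pi * M * t))) * complex_of_real (P (1 / 2) t)
    = (\<Sum>n\<in>S. c2 n * cis (2 * pi * of_int n * t))" for t
    using modulated_prod_sin_expansion[OF assms(1,2) S, of "1 / 2" "1 / 2" "\<lambda>k. \<psi> * (real k + 1 / 2)"]
    unfolding P_def M_def by blast
  have "complex_of_real (f t + \<epsilon> * g t) = (\<Sum>n\<in>S. (c1 n + \<epsilon> * c2 n) * cis (2 * pi * of_int n * t))" for t
  proof -
    have "complex_of_real (sin (pi * M * t)) = - \<i> / 2 * cis (pi * M * t) + \<i> / 2 * cis (- (pi * M * t))"
      "complex_of_real (cos (pi * M * t)) = 1 / 2 * cis (pi * M * t) + 1 / 2 * cis (- (pi * M * t))"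
      by (simp_all add: complex_eq_iff)
    then have "complex_of_real (f t) = (\<Sum>n\<in>S. c1 n * cis (2 * pi * of_int n * t))"
      "complex_of_real (g t) = (\<Sum>n\<in>S. c2 n * cis (2 * pi * of_int n * t))"
      by (simp_all only: f_def g_def of_real_mult c1 c2)
    then show ?thesis
      by (simp add: distrib_right sum.distrib sum_distrib_left mult.assoc)
  qed
  moreover have "finite S" by (simp add: S)
  ultimately have "real_trig_poly (\<lambda>t. f t + \<epsilon> * g t) \<and> spectrum (\<lambda>t. f t + \<epsilon> * g t) \<subseteq> S"
    by (intro real_trig_poly_expansion[where c = "\<lambda>n. c1 n + \<epsilon> * c2 n"])
  moreover have "f t + \<epsilon> * g t \<noteq> 0" if "t \<in> {\<delta>..L - \<delta>}" for t
    using \<epsilon>(2)[OF that] by simp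
  ultimately show ?thesis using that[of "\<lambda>t. f t + \<epsilon> * g t"] by blast
qed

section \<open>The value of the supremum\<close>

theorem theorem3:
  fixes N K b :: nat and S :: "int set"
  assumes "N > 0" and "K > 0" and "b > 0"
    and "b < 2 * N"
    and "S = (\<lambda>k. - int N - int k * int b) ` {0..K} \<union> (\<lambda>k. int N + int k * int b) ` {0..K}"
  shows "zero_free_sup S = (real K + 1) / (real b * real K + 2 * real N)"
proof (rule antisym)
  define L where "L = (real K + 1) / (real b * real K + 2 * real N)"
  define F where "F = {f. real_trig_poly f \<and> spectrum f \<subseteq> S}"
  define Is where "Is f = {I. is_interval I \<and> I \<subseteq> {0..1} \<and> (\<forall>t\<in>I. f t \<noteq> 0)}" for f :: "real \<Rightarrow> real"
  have sup: "zero_free_sup S = (SUP f\<in>F. SUP I\<in>Is f. measure lborel I)"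
    unfolding zero_free_sup_def F_def Is_def ..
  have le: "measure lborel I \<le> L" if "f \<in> F" "I \<in> Is f" for f I
    unfolding L_def using that assms
    by (intro zero_free_interval_le[of b N S K f]) (auto simp: F_def Is_def)
  have Is_ne: "Is f \<noteq> {}" for f by (auto simp: Is_def intro!: exI[of _ "{}"])
  have le': "(SUP I\<in>Is f. measure lborel I) \<le> L" if "f \<in> F" for f
    using Is_ne le[OF that] by (rule cSUP_least)
  have "(\<lambda>_. 0) \<in> F"
    using real_trig_poly_expansion[of S "\<lambda>_. 0" "\<lambda>_. 0"] assms(5) by (simp add: F_def)
  then have F_ne: "F \<noteq> {}" by blast
  show "zero_free_sup S \<le> (real K + 1) / (real b * real K + 2 * real N)"
    unfolding sup L_def[symmetric] using F_ne le' by (rule cSUP_least)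
  have "real K \<le> real b * real K" using \<open>b > 0\<close> mult_right_mono[of 1 "real b" "real K"] by simp
  then have "real K + 1 \<le> real b * real K + 2 * real N"
    using \<open>N > 0\<close> by linarith
  then have L: "0 < L" "L \<le> 1" by (auto simp: L_def intro!: divide_pos_pos)
  have "L - 2 * \<delta> \<le> zero_free_sup S" if \<delta>: "0 < \<delta>" "\<delta> < L / 2" for \<delta>
  proof -
    obtain f where f: "real_trig_poly f" "spectrum f \<subseteq> S" "\<And>t. t \<in> {\<delta>..L - \<delta>} \<Longrightarrow> f t \<noteq> 0"
      using exists_zero_free_interval[OF assms(1,3,4,5), of \<delta>] \<delta> unfolding L_def by blast
    have "{\<delta>..L - \<delta>} \<in> Is f" using f(3) \<delta> L by (auto simp: Is_def is_interval_cc)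
    moreover have "f \<in> F" using f by (simp add: F_def)
    moreover have "L - 2 * \<delta> \<le> measure lborel {\<delta>..L - \<delta>}" using \<delta> by simp
    ultimately show ?thesis unfolding sup
      using le le'
      by (intro cSUP_upper2[of _ F f] cSUP_upper2[of _ "Is f" "{\<delta>..L - \<delta>}"] bdd_aboveI2) auto
  qed
  note lower = this
  have "L \<le> zero_free_sup S"
  proof (rule field_le_epsilon)
    fix e :: real assume "0 < e"
    define \<delta> where "\<delta> = min (e / 2) (L / 4)"
    have "0 < \<delta>" "\<delta> < L / 2" "2 * \<delta> \<le> e" using \<open>0 < e\<close> L by (auto simp: \<delta>_def min_def)
    then show "L \<le> zero_free_sup S + e" using lower[of \<delta>] by linarith
  qed
  then show "(real K + 1) / (real b * real K + 2 * real N) \<le> zero_free_sup S"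
    by (simp add: L_def)
qed

end
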